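(* Let $X$ be a complete metric space, $\Phi:\mathbb{R}_+\rightrightarrows X$ a set-valued mapping, $t>0$ and $x\in\Phi(t)$. Suppose that $\Phi$ is outer semicontinuous at $0$ and there are sequences of positive numbers $(a_n)_{n\ge 0}$ and $(b_n)_{n\ge 0}$ such that $$\sum_{n=0}^{\infty}b_n<\infty,\qquad a_0=t,\qquad a_n\downarrow 0\ \text{ as } n\to\infty,$$ $$d(u,\Phi(a_{n+1}))<b_n\quad\text{for all } u\in\Phi(a_n)\cap U_n\quad(n=0,1,\ldots),$$ where $U_0:=\{x\}$ and $U_n:=B\left(x,\sum_{i=0}^{n-1}b_i\right)$ for $n=1,2,\ldots$. Then $d(x,\Phi(0))<\sum_{n=0}^{\infty}b_n$.
   Context: $\mathbb{R}_+=[0,\infty)$. $B(x,r)$ is the open ball of radius $r$ centered at $x$. $d(x,C)=\inf_{c\in C}d(x,c)$, with $d(x,\emptyset)=+\infty$. A set-valued mapping $\Phi:\mathbb{R}_+\rightrightarrows X$ assigns to each $\tau\in\mathbb{R}_+$ a (possibly empty) subset of $X$. $\Phi$ is outer semicontinuous at $\bar\tau\in\mathbb{R}_+$ if $\{z\in X\mid \liminf_{\tau\to\bar\tau,\,\tau\in\mathbb{R}_+}d(z,\Phi(\tau))=0\}\subset\Phi(\bar\tau)$. The notation $a_n\downarrow0$ means that the positive numbers $a_n$ converge to $0$. *)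

theory Defs
  imports "HOL-Analysis.Analysis"
begin

text \<open>The library's \<^const>\<open>infdist\<close> is 0 on the empty set. The distance used here is
  extended-real valued, so that the infimum over the empty set is \<open>\<infinity>\<close>.\<close>

definition set_dist :: "'a::metric_space \<Rightarrow> 'a set \<Rightarrow> ereal" where
  "set_dist x C = (INF c\<in>C. ereal (dist x c))"

text \<open>A set-valued mapping on \<open>[0, \<infinity>)\<close> is a function on \<^typ>\<open>real\<close> of which only the values at
  nonnegative arguments matter. The lower limit is over \<open>\<tau> \<noteq> \<tau>0\<close> (the filter \<open>at \<tau>0 within _\<close>);
  admitting \<open>\<tau> = \<tau>0\<close> would in addition require \<open>\<Phi> \<tau>0\<close> to be closed, a stronger property.\<close>

definition outer_semicontinuous_at :: "(real \<Rightarrow> 'a::metric_space set) \<Rightarrow> real \<Rightarrow> bool" where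
  "outer_semicontinuous_at \<Phi> \<tau>0 \<longleftrightarrow>
     {z. Liminf (at \<tau>0 within {0..}) (\<lambda>\<tau>. set_dist z (\<Phi> \<tau>)) = 0} \<subseteq> \<Phi> \<tau>0"

end

theory Submission
  imports Defs
begin

text \<open>
  The hypothesis on \<open>d(u, \<Phi>(a\<^sub>n\<^sub>+\<^sub>1))\<close> lets one walk along the graph of \<open>\<Phi>\<close>: starting from
  \<open>u\<^sub>0 = x\<close>, choose \<open>u\<^sub>n\<^sub>+\<^sub>1 \<in> \<Phi>(a\<^sub>n\<^sub>+\<^sub>1)\<close> at distance less than \<open>b\<^sub>n\<close> from \<open>u\<^sub>n\<close>. The triangle
  inequality keeps \<open>u\<^sub>n\<close> in \<open>U\<^sub>n\<close>, so the walk never stops (\<open>bounded_steps_selection\<close>).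
  The step lengths are summable, so by completeness the walk converges to some \<open>z\<close> and what
  remains of it from \<open>u\<^sub>n\<close> on is no longer than the tail of the series
  (\<open>summable_steps_limit\<close>). Since \<open>a\<^sub>n\<close> tends to \<open>0\<close> through nonzero values and \<open>\<Phi>(a\<^sub>n)\<close>
  contains \<open>u\<^sub>n\<close>, the lower limit of \<open>d(z, \<Phi>(\<tau>))\<close> at \<open>0\<close> vanishes, so outer semicontinuity puts
  \<open>z\<close> in \<open>\<Phi>(0)\<close> (\<open>outer_semicontinuous_at_sequentially\<close>).

  The final inequality is strict because the first step is strictly shorter than \<open>b\<^sub>0\<close>: the tail
  estimate is applied from \<open>u\<^sub>1\<close> on, not from \<open>x\<close>, since the passage to the limit loses
  strictness.
\<close>

lemma set_dist_nonneg: "0 \<le> set_dist x C"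
  unfolding set_dist_def by (rule INF_greatest) simp

lemma set_dist_le: "c \<in> C \<Longrightarrow> set_dist x C \<le> ereal (dist x c)"
  unfolding set_dist_def by (rule INF_lower)

lemma set_dist_lessE:
  assumes "set_dist x C < ereal r"
  obtains c where "c \<in> C" "dist x c < r"
  using assms unfolding set_dist_def by (auto simp: INF_less_iff)

text \<open>
  A lower limit at \<open>\<tau>\<close> is bounded by the limit along any one sequence approaching \<open>\<tau>\<close>. The
  sequence has to avoid \<open>\<tau>\<close> itself because the lower limit is over a punctured neighbourhood.
\<close>

lemma outer_semicontinuous_at_sequentially:
  fixes \<Phi> :: "real \<Rightarrow> 'a::metric_space set"
  assumes osc: "outer_semicontinuous_at \<Phi> \<tau>"
    and "a \<longlonglongrightarrow> \<tau>" "\<And>n. a n \<ge> 0" "\<And>n. a n \<noteq> \<tau>"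
    and "u \<longlonglongrightarrow> z" and u: "\<And>n. u n \<in> \<Phi> (a n)"
  shows "z \<in> \<Phi> \<tau>"
proof -
  let ?F = "at \<tau> within {0..}"
  let ?L = "Liminf ?F (\<lambda>\<sigma>. set_dist z (\<Phi> \<sigma>))"
  have lim_a: "filterlim a ?F sequentially"
    using assms(2-4) by (auto simp: filterlim_at)
  have "?L \<le> 0"
  proof (rule ccontr)
    assume "\<not> ?L \<le> 0"
    then obtain r where r: "0 < ereal r" "ereal r < ?L"
      using ereal_dense2[of 0 ?L] unfolding not_le by blast
    then have "eventually (\<lambda>\<sigma>. ereal r < set_dist z (\<Phi> \<sigma>)) ?F"
      by (auto dest: less_LiminfD)
    then have "eventually (\<lambda>n. ereal r < set_dist z (\<Phi> (a n))) sequentially"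
      using lim_a by (rule eventually_compose_filterlim)
    moreover have "eventually (\<lambda>n. dist (u n) z < r) sequentially"
      using \<open>u \<longlonglongrightarrow> z\<close> r(1) by (auto dest: tendstoD)
    ultimately have "eventually (\<lambda>n. False) sequentially"
    proof eventually_elim
      case (elim n)
      have "ereal r < ereal (dist z (u n))"
        using elim(1) set_dist_le[OF u] by (rule less_le_trans)
      then show ?case
        using elim(2) by (simp add: dist_commute)
    qed
    then show False by simp
  qed
  moreover have "0 \<le> ?L"
    by (rule Liminf_bounded) (simp add: set_dist_nonneg)
  ultimately have "?L = 0" by (rule antisym)
  then show ?thesis
    using osc unfolding outer_semicontinuous_at_def by blast
qed

text \<open>
  The distance between two terms is at most a difference of partial sums of \<open>b\<close>, hence at most
  a tail, and tails tend to \<open>0\<close>. The estimate from every index on lets the first steps be measured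
  separately.
\<close>

lemma summable_steps_limit:
  fixes u :: "nat \<Rightarrow> 'a::complete_space" and b :: "nat \<Rightarrow> real"
  assumes "summable b" and step: "\<And>n. dist (u n) (u (Suc n)) \<le> b n"
  obtains z where "u \<longlonglongrightarrow> z" "\<And>m. dist (u m) z \<le> suminf b - sum b {..<m}"
proof -
  define r where "r m = suminf b - sum b {..<m}" for m
  have nonneg: "0 \<le> b n" for n
    using step[of n] zero_le_dist order_trans by blast
  have partial: "dist (u m) (u n) \<le> sum b {..<n} - sum b {..<m}" if "m \<le> n" for m n
    using that
  proof (induction n rule: dec_induct)
    case (step n)
    then show ?case
      using dist_triangle[of "u m" "u (Suc n)" "u n"] assms(2)[of n] by simp
  qed simp
  have tail: "dist (u m) (u n) \<le> r m" if "m \<le> n" for m n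
    using partial[OF that] sum_le_suminf[OF \<open>summable b\<close>, of "{..<n}"] nonneg
    by (simp add: r_def)
  have "r \<longlonglongrightarrow> suminf b - suminf b"
    unfolding r_def by (intro tendsto_intros summable_LIMSEQ \<open>summable b\<close>)
  then have r_lim: "r \<longlonglongrightarrow> 0" by simp
  have "Cauchy u"
  proof (rule metric_CauchyI)
    fix e :: real
    assume "e > 0"
    then have "eventually (\<lambda>m. r m < e / 2) sequentially"
      using order_tendstoD(2)[OF r_lim, of "e / 2"] by simp
    then obtain M where "r M < e / 2"
      unfolding eventually_sequentially by blast
    then show "\<exists>M. \<forall>m\<ge>M. \<forall>n\<ge>M. dist (u m) (u n) < e"
      using tail by (meson dist_triangle_half_r order_le_less_trans)
  qed
  then obtain z where z: "u \<longlonglongrightarrow> z"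
    using Cauchy_convergent convergent_def by blast
  have "dist (u m) z \<le> r m" for m
  proof (rule LIMSEQ_le_const2)
    show "(\<lambda>n. dist (u m) (u n)) \<longlonglongrightarrow> dist (u m) z"
      using z by (intro tendsto_intros)
  qed (use tail in blast)
  then show thesis
    using that z by (simp add: r_def)
qed

text \<open>
  The radii in the hypothesis are exactly what the triangle inequality yields: a step shorter than
  \<open>b\<^sub>n\<close> from a point of \<open>U\<^sub>n\<close> ends in \<open>U\<^sub>n\<^sub>+\<^sub>1\<close>. The set \<open>U\<^sub>0\<close> is given separately as \<open>{x}\<close>,
  because the open ball of radius \<open>0\<close> is empty.
\<close>

lemma bounded_steps_selection:
  fixes S :: "nat \<Rightarrow> 'a::metric_space set" and b :: "nat \<Rightarrow> real" and x :: 'a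
  defines "U \<equiv> \<lambda>n. if n = 0 then {x} else ball x (\<Sum>i<n. b i)"
  assumes "x \<in> S 0"
    and near: "\<And>n u. u \<in> S n \<inter> U n \<Longrightarrow> set_dist u (S (Suc n)) < ereal (b n)"
  obtains u where "u 0 = x" "\<And>n. u n \<in> S n" "\<And>n. dist (u n) (u (Suc n)) < b n"
proof -
  have "\<exists>u. \<forall>n. u n \<in> S n \<inter> U n \<and> dist (u n) (u (Suc n)) < b n"
  proof (rule dependent_nat_choice)
    show "\<exists>v. v \<in> S 0 \<inter> U 0"
      using \<open>x \<in> S 0\<close> by (auto simp: U_def)
  next
    fix v n
    assume v: "v \<in> S n \<inter> U n"
    obtain w where w: "w \<in> S (Suc n)" "dist v w < b n"
      using near[OF v] by (rule set_dist_lessE)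
    have "dist x v \<le> (\<Sum>i<n. b i)"
      using v by (auto simp: U_def split: if_splits)
    then have "w \<in> U (Suc n)"
      using w(2) dist_triangle[of x w v] by (simp add: U_def)
    with w show "\<exists>w. w \<in> S (Suc n) \<inter> U (Suc n) \<and> dist v w < b n"
      by blast
  qed
  then obtain u where u: "\<And>n. u n \<in> S n \<inter> U n" "\<And>n. dist (u n) (u (Suc n)) < b n"
    by blast
  moreover have "u 0 = x"
    using u(1)[of 0] by (simp add: U_def)
  ultimately show thesis
    using that by blast
qed

theorem lemma2p1:
  fixes \<Phi> :: "real \<Rightarrow> 'a::complete_space set"
    and t :: real
    and x :: 'a
    and a b :: "nat \<Rightarrow> real"
  assumes "t > 0"
    and "x \<in> \<Phi> t"
    and "outer_semicontinuous_at \<Phi> 0"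
    and "\<And>n. a n > 0"
    and "\<And>n. b n > 0"
    and "summable b"
    and "a 0 = t"
    and "a \<longlonglongrightarrow> 0"
    and "\<And>n u. u \<in> \<Phi> (a n) \<inter> (if n = 0 then {x} else ball x (\<Sum>i<n. b i)) \<Longrightarrow>
           set_dist u (\<Phi> (a (Suc n))) < ereal (b n)"
  shows "set_dist x (\<Phi> 0) < ereal (\<Sum>n. b n)"
proof -
  have "x \<in> \<Phi> (a 0)"
    using assms(2,7) by simp
  then obtain u where u: "u 0 = x" "\<And>n. u n \<in> \<Phi> (a n)" "\<And>n. dist (u n) (u (Suc n)) < b n"
    using bounded_steps_selection[of x "\<lambda>n. \<Phi> (a n)" b] assms(9) by blast
  obtain z where z: "u \<longlonglongrightarrow> z" "\<And>m. dist (u m) z \<le> suminf b - sum b {..<m}"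
    using summable_steps_limit[OF assms(6)] u(3) less_imp_le by metis
  have "z \<in> \<Phi> 0"
    using outer_semicontinuous_at_sequentially[OF assms(3,8) _ _ z(1) u(2)] assms(4)
    by (simp add: less_imp_le less_imp_neq[symmetric])
  have "dist x z < suminf b"
    using dist_triangle[of x z "u 1"] u(3)[of 0] z(2)[of 1] u(1) by simp
  then show ?thesis
    using set_dist_le[OF \<open>z \<in> \<Phi> 0\<close>] by (meson ereal_less_eq(3) less_ereal.simps(1) order_le_less_trans)
qed

end
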